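(* Let $a(x),c(x),\tilde a(x),\tilde c(x)\in\mathbb{C}[x]$ and let $$g=\begin{pmatrix} a(x) & 0\\ 0 & c(x)\end{pmatrix},\qquad \tilde g=\begin{pmatrix}\tilde a(x) & 0\\ 0 & \tilde c(x)\end{pmatrix}$$ be such that $\det(g)\neq 0$ and $\det(\tilde g)\neq 0$. Let $\mathcal{K}=(\mathcal{A}(x,y),g,\{x,y\})$ and $\tilde{\mathcal{K}}=(\mathcal{A}(x,y),\tilde g,\{x,y\})$ be the corresponding Kähler-Poisson algebras. Then $\mathcal{K}\cong\tilde{\mathcal{K}}$ (as Kähler-Poisson algebras) if and only if there exists $\alpha\in\mathbb{C}$ such that (1) $\tilde c(x)=c(\alpha x)$, and (2) $\tilde a(x)=\alpha^2a(\alpha x)$.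
   Context: $\mathcal{A}(x,y)$ denotes the Poisson algebra over $\mathbb{C}$ whose underlying commutative algebra is the field $\mathbb{C}(x,y)$ of rational functions in two variables, with the Poisson bracket determined by $\{x,y\}=x$ (extended from $\mathbb{C}[x,y]$ by the Leibniz rule). Explicitly, $\{f,h\}=x\left(\frac{\partial f}{\partial x}\frac{\partial h}{\partial y}-\frac{\partial f}{\partial y}\frac{\partial h}{\partial x}\right)$. Kähler-Poisson algebra: let $(\mathcal{A},\{\cdot,\cdot\})$ be a Poisson algebra over $\mathbb{C}$, $x^1,\dots,x^m\in\mathcal{A}$, and $g=(g_{ij})$ a symmetric $m\times m$ matrix with entries in $\mathcal{A}$. The triple $\mathcal{K}=(\mathcal{A},g,\{x^1,\dots,x^m\})$ is a Kähler-Poisson algebra if there exists $\eta\in\mathcal{A}$ such that $\sum_{i,j,k,l=1}^m\eta\{a,x^i\}g_{ij}\{x^j,x^k\}g_{kl}\{x^l,b\}=-\{a,b\}$ for all $a,b\in\mathcal{A}$. In the triple $(\mathcal{A}(x,y),g,\{x,y\})$, the last entry is the set of distinguished elements $x^1=x$, $x^2=y$ (not a bracket). For such $\mathcal{K}$, let $\mathfrak{g}$ be the $\mathcal{A}$-module generated by all inner derivations $\{c,\cdot\}$, $c\in\mathcal{A}$; it is a Lie algebra under the commutator of derivations. Put $g(\alpha,\beta)=\sum_{i,j}\alpha(x^i)g_{ij}\beta(x^j)$ for $\alpha,\beta\in\mathfrak{g}$, and let $\mathcal{A}_{\mathrm{fin}}\subseteq\mathcal{A}$ be the subalgebra generated by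 $x^1,\dots,x^m$. A morphism of Kähler-Poisson algebras $\mathcal{K}\to\mathcal{K}'=(\mathcal{A}',g',\{y^1,\dots,y^{m'}\})$ is a pair $(\phi,\psi)$, with $\phi:\mathcal{A}\to\mathcal{A}'$ a (unital) Poisson algebra homomorphism and $\psi:\mathfrak{g}\to\mathfrak{g}'$ a Lie algebra homomorphism, such that for all $a\in\mathcal{A}$, $\alpha,\beta\in\mathfrak{g}$: (1) $\psi(a\alpha)=\phi(a)\psi(\alpha)$; (2) $\phi(\alpha(a))=\psi(\alpha)(\phi(a))$; (3) $\phi(g(\alpha,\beta))=g'(\psi(\alpha),\psi(\beta))$; (4) $\phi(\mathcal{A}_{\mathrm{fin}})\subseteq\mathcal{A}'_{\mathrm{fin}}$. $\mathcal{K}\cong\mathcal{K}'$ means there is such a morphism having an inverse morphism. *)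

theory Defs
  imports "HOL-Analysis.Analysis" "HOL-Computational_Algebra.Computational_Algebra"
begin

text \<open>The underlying commutative algebra is a whole type of class \<open>comm_ring_1\<close>, with
  \<open>scale\<close> its scalar multiplication. Additivity and homogeneity of the bracket in the first
  argument follow from antisymmetry.\<close>

locale poisson_algebra = vector_space scale
  for scale :: "complex \<Rightarrow> 'a::comm_ring_1 \<Rightarrow> 'a" +
  fixes bracket :: "'a \<Rightarrow> 'a \<Rightarrow> 'a"
  assumes scale_mult: "scale z a * b = scale z (a * b)"
    and bracket_add: "bracket a (b + c) = bracket a b + bracket a c"
    and bracket_scale: "bracket a (scale z b) = scale z (bracket a b)"
    and bracket_antisym: "bracket a b = - bracket b a"
    and bracket_jacobi:
      "bracket a (bracket b c) + bracket b (bracket c a) + bracket c (bracket a b) = 0"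
    and bracket_leibniz: "bracket a (b * c) = bracket a b * c + b * bracket a c"

text \<open>The distinguished elements form a vector \<open>gens\<close>, indexed, like the rows and columns of the
  metric, by a finite type \<open>'m\<close> with \<open>CARD('m) = m\<close>.\<close>

record ('a, 'm::finite) kp_data =
  scale :: "complex \<Rightarrow> 'a \<Rightarrow> 'a"
  bracket :: "'a \<Rightarrow> 'a \<Rightarrow> 'a"
  metric :: "'a^'m^'m"
  gens :: "'a^'m"

definition kaehler_poisson :: "('a::comm_ring_1, 'm::finite) kp_data \<Rightarrow> bool" where
  "kaehler_poisson K \<longleftrightarrow>
     poisson_algebra (scale K) (bracket K) \<and>
     transpose (metric K) = metric K \<and>
     (\<exists>\<eta>. \<forall>a b.
        (\<Sum>i\<in>UNIV. \<Sum>j\<in>UNIV. \<Sum>k\<in>UNIV. \<Sum>l\<in>UNIV.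
           \<eta> * bracket K a (gens K $ i) * metric K $ i $ j * bracket K (gens K $ j) (gens K $ k)
             * metric K $ k $ l * bracket K (gens K $ l) b)
        = - bracket K a b)"

text \<open>The module \<open>\<gg>\<close> generated by the inner derivations \<open>{c, \<cdot>}\<close>, as a set of functions.\<close>

definition inner_ders :: "('a::comm_ring_1, 'm::finite) kp_data \<Rightarrow> ('a \<Rightarrow> 'a) set" where
  "inner_ders K = {\<lambda>b. \<Sum>i<n. r i * bracket K (c i) b | (n::nat) r c. True}"

definition metric_form ::
  "('a::comm_ring_1, 'm::finite) kp_data \<Rightarrow> ('a \<Rightarrow> 'a) \<Rightarrow> ('a \<Rightarrow> 'a) \<Rightarrow> 'a" where
  "metric_form K \<alpha> \<beta> =
     (\<Sum>i\<in>UNIV. \<Sum>j\<in>UNIV. \<alpha> (gens K $ i) * metric K $ i $ j * \<beta> (gens K $ j))"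

definition is_subalgebra :: "('a::comm_ring_1, 'm::finite) kp_data \<Rightarrow> 'a set \<Rightarrow> bool" where
  "is_subalgebra K S \<longleftrightarrow> 1 \<in> S \<and>
     (\<forall>a\<in>S. \<forall>b\<in>S. a + b \<in> S \<and> a * b \<in> S) \<and> (\<forall>z. \<forall>a\<in>S. scale K z a \<in> S)"

definition fin_subalgebra :: "('a::comm_ring_1, 'm::finite) kp_data \<Rightarrow> 'a set" where
  "fin_subalgebra K = is_subalgebra K hull range (\<lambda>i. gens K $ i)"

definition poisson_hom ::
  "('a::comm_ring_1, 'm::finite) kp_data \<Rightarrow> ('b::comm_ring_1, 'n::finite) kp_data
     \<Rightarrow> ('a \<Rightarrow> 'b) \<Rightarrow> bool" where
  "poisson_hom K K' \<phi> \<longleftrightarrow>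
     Vector_Spaces.linear (scale K) (scale K') \<phi> \<and>
     \<phi> 1 = 1 \<and>
     (\<forall>a b. \<phi> (a * b) = \<phi> a * \<phi> b) \<and>
     (\<forall>a b. \<phi> (bracket K a b) = bracket K' (\<phi> a) (\<phi> b))"

text \<open>Only the values of \<open>\<psi>\<close> on \<open>\<gg>\<close> matter; the Lie bracket is the commutator.\<close>

definition inner_ders_lie_hom ::
  "('a::comm_ring_1, 'm::finite) kp_data \<Rightarrow> ('b::comm_ring_1, 'n::finite) kp_data
     \<Rightarrow> (('a \<Rightarrow> 'a) \<Rightarrow> ('b \<Rightarrow> 'b)) \<Rightarrow> bool" where
  "inner_ders_lie_hom K K' \<psi> \<longleftrightarrow>
     (\<forall>\<alpha>\<in>inner_ders K. \<psi> \<alpha> \<in> inner_ders K') \<and>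
     (\<forall>\<alpha>\<in>inner_ders K. \<forall>\<beta>\<in>inner_ders K.
        \<psi> (\<lambda>b. \<alpha> b + \<beta> b) = (\<lambda>b. \<psi> \<alpha> b + \<psi> \<beta> b)) \<and>
     (\<forall>z. \<forall>\<alpha>\<in>inner_ders K. \<psi> (\<lambda>b. scale K z (\<alpha> b)) = (\<lambda>b. scale K' z (\<psi> \<alpha> b))) \<and>
     (\<forall>\<alpha>\<in>inner_ders K. \<forall>\<beta>\<in>inner_ders K.
        \<psi> (\<lambda>b. \<alpha> (\<beta> b) - \<beta> (\<alpha> b)) = (\<lambda>b. \<psi> \<alpha> (\<psi> \<beta> b) - \<psi> \<beta> (\<psi> \<alpha> b)))"

definition kp_morphism ::
  "('a::comm_ring_1, 'm::finite) kp_data \<Rightarrow> ('b::comm_ring_1, 'n::finite) kp_data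
     \<Rightarrow> ('a \<Rightarrow> 'b) \<Rightarrow> (('a \<Rightarrow> 'a) \<Rightarrow> ('b \<Rightarrow> 'b)) \<Rightarrow> bool" where
  "kp_morphism K K' \<phi> \<psi> \<longleftrightarrow>
     kaehler_poisson K \<and> kaehler_poisson K' \<and>
     poisson_hom K K' \<phi> \<and> inner_ders_lie_hom K K' \<psi> \<and>
     (\<forall>a. \<forall>\<alpha>\<in>inner_ders K. \<psi> (\<lambda>b. a * \<alpha> b) = (\<lambda>b. \<phi> a * \<psi> \<alpha> b)) \<and>
     (\<forall>a. \<forall>\<alpha>\<in>inner_ders K. \<phi> (\<alpha> a) = \<psi> \<alpha> (\<phi> a)) \<and>
     (\<forall>\<alpha>\<in>inner_ders K. \<forall>\<beta>\<in>inner_ders K.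
        \<phi> (metric_form K \<alpha> \<beta>) = metric_form K' (\<psi> \<alpha>) (\<psi> \<beta>)) \<and>
     \<phi> ` fin_subalgebra K \<subseteq> fin_subalgebra K'"

definition kp_isomorphic ::
  "('a::comm_ring_1, 'm::finite) kp_data \<Rightarrow> ('b::comm_ring_1, 'n::finite) kp_data \<Rightarrow> bool"
  where
  "kp_isomorphic K K' \<longleftrightarrow>
     (\<exists>\<phi> \<psi> \<phi>' \<psi>'. kp_morphism K K' \<phi> \<psi> \<and> kp_morphism K' K \<phi>' \<psi>' \<and>
        (\<forall>a. \<phi>' (\<phi> a) = a) \<and> (\<forall>b. \<phi> (\<phi>' b) = b) \<and>
        (\<forall>\<alpha>\<in>inner_ders K. \<psi>' (\<psi> \<alpha>) = \<alpha>) \<and> (\<forall>\<beta>\<in>inner_ders K'. \<psi> (\<psi>' \<beta>) = \<beta>))"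

text \<open>\<open>\<C>(x,y)\<close> is the fraction field of \<open>\<C>[x][y]\<close>: the variable of the coefficients is \<open>x\<close>, the
  outer variable is \<open>y\<close>.\<close>

type_synonym ratfun2 = "complex poly poly fract"

definition ratfun_of_poly :: "complex poly \<Rightarrow> ratfun2" where
  "ratfun_of_poly p = Fract [:p:] 1"

definition var_x :: ratfun2 where "var_x = Fract [:[:0, 1:]:] 1"

definition var_y :: ratfun2 where "var_y = Fract [:0, 1:] 1"

definition ratfun_scale :: "complex \<Rightarrow> ratfun2 \<Rightarrow> ratfun2" where
  "ratfun_scale z f = ratfun_of_poly [:z:] * f"

lemma map_poly_pderiv_add:
  "map_poly pderiv (p + q) = map_poly pderiv p + map_poly pderiv (q :: complex poly poly)"
  by (rule poly_eqI) (simp add: coeff_map_poly pderiv_add)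

lemma map_poly_pderiv_mult:
  "map_poly pderiv (p * q) = map_poly pderiv p * q + p * map_poly pderiv (q :: complex poly poly)"
proof (induction p)
  case (pCons a p)
  have "map_poly pderiv (smult a r) = smult (pderiv a) r + smult a (map_poly pderiv r)"
    for r :: "complex poly poly"
    by (rule poly_eqI) (simp add: coeff_map_poly pderiv_mult)
  with pCons show ?case
    by (simp add: map_poly_pCons map_poly_pderiv_add algebra_simps)
qed simp

text \<open>The extension of a derivation \<open>D\<close> of an integral domain to its field of fractions by the
  quotient rule; the value does not depend on the representing fraction.\<close>

definition fract_deriv :: "('p::idom \<Rightarrow> 'p) \<Rightarrow> 'p fract \<Rightarrow> 'p fract" where
  "fract_deriv D f =
     (THE g. \<exists>p q. q \<noteq> 0 \<and> f = Fract p q \<and> g = Fract (D p * q - p * D q) (q * q))"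

lemma fract_deriv_Fract:
  fixes D :: "'p::idom \<Rightarrow> 'p"
  assumes D: "\<And>p q. D (p * q) = D p * q + p * D q" and q: "q \<noteq> 0"
  shows "fract_deriv D (Fract p q) = Fract (D p * q - p * D q) (q * q)"
  unfolding fract_deriv_def
proof (rule the_equality)
  show "\<exists>p' q'. q' \<noteq> 0 \<and> Fract p q = Fract p' q' \<and>
      Fract (D p * q - p * D q) (q * q) = Fract (D p' * q' - p' * D q') (q' * q')"
    using q by blast
next
  fix g assume "\<exists>r s. s \<noteq> 0 \<and> Fract p q = Fract r s \<and> g = Fract (D r * s - r * D s) (s * s)"
  then obtain r s where s: "s \<noteq> 0" and "Fract p q = Fract r s"
    and g: "g = Fract (D r * s - r * D s) (s * s)" by blast
  then have eq: "p * s = r * q" using q by (simp add: eq_fract)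
  then have "D p * s + p * D s = D r * q + r * D q" using D by metis
  with eq have "(D p * q - p * D q) * (s * s) = (D r * s - r * D s) * (q * q)" by algebra
  with q s show "g = Fract (D p * q - p * D q) (q * q)" by (simp add: g eq_fract)
qed

definition ratfun_dx :: "ratfun2 \<Rightarrow> ratfun2" where
  "ratfun_dx = fract_deriv (map_poly pderiv)"

definition ratfun_dy :: "ratfun2 \<Rightarrow> ratfun2" where
  "ratfun_dy = fract_deriv pderiv"

lemma ratfun_dx_Fract:
  "q \<noteq> 0 \<Longrightarrow> ratfun_dx (Fract p q) = Fract (map_poly pderiv p * q - p * map_poly pderiv q) (q * q)"
  unfolding ratfun_dx_def by (rule fract_deriv_Fract[OF map_poly_pderiv_mult])

lemma ratfun_dy_Fract:
  "q \<noteq> 0 \<Longrightarrow> ratfun_dy (Fract p q) = Fract (pderiv p * q - p * pderiv q) (q * q)"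
  unfolding ratfun_dy_def by (rule fract_deriv_Fract) (simp_all add: pderiv_mult algebra_simps)

definition ratfun_bracket :: "ratfun2 \<Rightarrow> ratfun2 \<Rightarrow> ratfun2" where
  "ratfun_bracket f h = var_x * (ratfun_dx f * ratfun_dy h - ratfun_dy f * ratfun_dx h)"

lemma ratfun_bracket_var: "ratfun_bracket var_x var_y = var_x"
  by (simp add: ratfun_bracket_def var_x_def var_y_def ratfun_dx_Fract ratfun_dy_Fract
      map_poly_pCons map_poly_1 pderiv_pCons)

definition diag_metric :: "complex poly \<Rightarrow> complex poly \<Rightarrow> ratfun2^2^2" where
  "diag_metric a c = vector [vector [ratfun_of_poly a, 0], vector [0, ratfun_of_poly c]]"

definition ratfun_kp :: "ratfun2^2^2 \<Rightarrow> (ratfun2, 2) kp_data" where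
  "ratfun_kp g = \<lparr>scale = ratfun_scale, bracket = ratfun_bracket,
     metric = g, gens = vector [var_x, var_y]\<rparr>"

end

theory Submission
  imports Defs
begin

text \<open>Both directions of a morphism preserve \<open>\<C>[x,y]\<close>, and
  \<open>{\<theta> x, \<theta> y} = \<theta> x\<close> shows that \<open>x\<close> divides \<open>\<theta> x\<close> there; as \<open>x\<close> is irreducible, an invertible
  Poisson homomorphism \<open>\<theta>\<close> satisfies \<open>\<theta> x = \<beta> x\<close> with \<open>\<beta> \<noteq> 0\<close>, and then \<open>\<theta> y = y + r(x)\<close>. The Lie algebra
  part of the morphism is conjugation by \<open>\<theta>\<close>, so comparing the metrics on the derivations
  \<open>{x, \<cdot>}\<close> and \<open>{y, \<cdot>}\<close> gives the formula for \<open>c'\<close>, the vanishing of \<open>r'\<close> (off-diagonal entry)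
  and the formula for \<open>a'\<close>. Conversely \<open>x \<mapsto> \<alpha> x, y \<mapsto> y\<close> is an isomorphism; \<open>\<alpha> = 0\<close> is excluded
  because it would give \<open>a' = 0\<close>.\<close>

no_notation fps_nth (infixl \<open>$\<close> 75)

section \<open>Derivations and embeddings of fraction fields\<close>

text \<open>Stated over an arbitrary integral domain, so that it can be instantiated first on
  polynomials and then, through \<open>fract_derivation\<close>, on their fraction field.\<close>

locale idom_derivation =
  fixes D :: "'p::idom \<Rightarrow> 'p"
  assumes add: "D (p + q) = D p + D q"
    and mult: "D (p * q) = D p * q + p * D q"
begin

lemma one [simp]: "D 1 = 0"
  by (metis mult add_cancel_left_left mult_1_left mult_1_right)

lemma fract_deriv_to_fract [simp]: "fract_deriv D (to_fract p) = to_fract (D p)"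
  by (simp add: to_fract_def fract_deriv_Fract[OF mult])

lemma fract_derivation: "idom_derivation (fract_deriv D)"
proof
  fix f g :: "'p fract"
  obtain p q where f: "f = Fract p q" "q \<noteq> 0" by (cases f)
  obtain r s where g: "g = Fract r s" "s \<noteq> 0" by (cases g)
  show "fract_deriv D (f + g) = fract_deriv D f + fract_deriv D g"
    using f g by (simp add: fract_deriv_Fract[OF mult] eq_fract mult add algebra_simps)
  show "fract_deriv D (f * g) = fract_deriv D f * g + f * fract_deriv D g"
    using f g by (simp add: fract_deriv_Fract[OF mult] eq_fract mult add algebra_simps)
qed

lemma diff: "D (p - q) = D p - D q"
  by (metis add add_diff_cancel_right' diff_add_cancel)

end

text \<open>The commutator of two derivations is a derivation, so it vanishes on fractions as soon as it
  vanishes on numerators and denominators.\<close>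

lemma fract_deriv_commute:
  fixes D E :: "'p::idom \<Rightarrow> 'p"
  assumes D: "idom_derivation D" and E: "idom_derivation E"
    and comm: "\<And>p. D (E p) = E (D p)"
  shows "fract_deriv D (fract_deriv E f) = fract_deriv E (fract_deriv D f)"
proof -
  interpret D: idom_derivation D by fact
  interpret E: idom_derivation E by fact
  interpret D': idom_derivation "fract_deriv D" by (rule D.fract_derivation)
  interpret E': idom_derivation "fract_deriv E" by (rule E.fract_derivation)
  define C where "C g = fract_deriv D (fract_deriv E g) - fract_deriv E (fract_deriv D g)" for g
  have C_mult: "C (g * h) = C g * h + g * C h" for g h
    by (simp add: C_def D'.mult E'.mult D'.add E'.add algebra_simps)
  have C_poly: "C (to_fract p) = 0" for p
    by (simp add: C_def comm)
  obtain p q where f: "f = Fract p q" "q \<noteq> 0" by (cases f)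
  then have "C (f * to_fract q) = C (to_fract p)"
    by (simp add: Fract_conv_to_fract)
  then have "C f * to_fract q = 0"
    by (simp add: C_mult C_poly)
  with f(2) show ?thesis by (simp add: C_def)
qed

text \<open>The trivial kernel keeps denominators nonzero, which is what lets such a map extend to
  fractions.\<close>

locale idom_embedding =
  fixes h :: "'p::idom \<Rightarrow> 'q::idom"
  assumes add: "h (p + q) = h p + h q"
    and mult: "h (p * q) = h p * h q"
    and one [simp]: "h 1 = 1"
    and eq_0_iff [simp]: "h p = 0 \<longleftrightarrow> p = 0"

definition fract_map :: "('p::idom \<Rightarrow> 'q::idom) \<Rightarrow> 'p fract \<Rightarrow> 'q fract" where
  "fract_map h f = (THE g. \<exists>p q. q \<noteq> 0 \<and> f = Fract p q \<and> g = Fract (h p) (h q))"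

context idom_embedding
begin

lemma diff: "h (p - q) = h p - h q"
  by (metis add add_diff_cancel_right' diff_add_cancel)

text \<open>Well-definedness: \<open>h\<close> carries the cross-multiplied identity of two
  representing fractions over, and both denominators stay nonzero.\<close>

lemma fract_map_Fract:
  assumes q: "q \<noteq> 0"
  shows "fract_map h (Fract p q) = Fract (h p) (h q)"
  unfolding fract_map_def
proof (rule the_equality)
  show "\<exists>p' q'. q' \<noteq> 0 \<and> Fract p q = Fract p' q' \<and> Fract (h p) (h q) = Fract (h p') (h q')"
    using q by blast
next
  fix g assume "\<exists>r s. s \<noteq> 0 \<and> Fract p q = Fract r s \<and> g = Fract (h r) (h s)"
  then obtain r s where s: "s \<noteq> 0" "p * s = r * q" and g: "g = Fract (h r) (h s)"
    using q by (auto simp: eq_fract)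
  then have "h p * h s = h r * h q"
    by (metis mult)
  with q s g show "g = Fract (h p) (h q)"
    by (simp add: eq_fract)
qed

lemma fract_map_to_fract [simp]: "fract_map h (to_fract p) = to_fract (h p)"
  by (simp add: to_fract_def fract_map_Fract)

lemma fract_map_add: "fract_map h (f + g) = fract_map h f + fract_map h g"
  by (cases f; cases g) (simp add: fract_map_Fract add mult)

lemma fract_map_mult: "fract_map h (f * g) = fract_map h f * fract_map h g"
  by (cases f; cases g) (simp add: fract_map_Fract mult)

end

section \<open>The Poisson algebra\<close>

lemma idom_derivation_dx: "idom_derivation (map_poly pderiv :: complex poly poly \<Rightarrow> _)"
  by standard (simp_all add: map_poly_pderiv_add map_poly_pderiv_mult)

lemma idom_derivation_dy: "idom_derivation (pderiv :: complex poly poly \<Rightarrow> _)"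
  by standard (simp_all add: pderiv_add pderiv_mult algebra_simps)

interpretation dx: idom_derivation ratfun_dx
  unfolding ratfun_dx_def by (rule idom_derivation.fract_derivation[OF idom_derivation_dx])

interpretation dy: idom_derivation ratfun_dy
  unfolding ratfun_dy_def by (rule idom_derivation.fract_derivation[OF idom_derivation_dy])

lemma ratfun_dx_to_fract: "ratfun_dx (to_fract p) = to_fract (map_poly pderiv p)"
  unfolding ratfun_dx_def
  by (rule idom_derivation.fract_deriv_to_fract[OF idom_derivation_dx])

lemma ratfun_dy_to_fract: "ratfun_dy (to_fract p) = to_fract (pderiv p)"
  unfolding ratfun_dy_def
  by (rule idom_derivation.fract_deriv_to_fract[OF idom_derivation_dy])

text \<open>The factor that \<open>pderiv\<close> puts in front of a coefficient is an integer
  constant, so differentiating the coefficients commutes with it. The Jacobi identity rests on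
  this.\<close>

lemma ratfun_dx_dy: "ratfun_dx (ratfun_dy f) = ratfun_dy (ratfun_dx f)"
  unfolding ratfun_dx_def ratfun_dy_def
proof (rule fract_deriv_commute[OF idom_derivation_dx idom_derivation_dy])
  show "map_poly pderiv (pderiv p) = pderiv (map_poly pderiv p)" for p :: "complex poly poly"
    by (rule poly_eqI) (simp add: coeff_map_poly coeff_pderiv pderiv_mult flip: of_nat_Suc)
qed

lemma ratfun_of_poly_altdef: "ratfun_of_poly p = to_fract [:p:]"
  by (simp add: ratfun_of_poly_def to_fract_def)

lemma var_x_altdef: "var_x = to_fract [:[:0, 1:]:]"
  by (simp add: var_x_def to_fract_def)

lemma var_y_altdef: "var_y = to_fract [:0, 1:]"
  by (simp add: var_y_def to_fract_def)

lemma ratfun_of_poly_simps [simp]: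
  "ratfun_of_poly 0 = 0" "ratfun_of_poly 1 = 1"
  "ratfun_of_poly p = 0 \<longleftrightarrow> p = 0"
  "ratfun_of_poly p = ratfun_of_poly q \<longleftrightarrow> p = q"
  by (simp_all add: ratfun_of_poly_altdef flip: one_pCons)

lemma ratfun_of_poly_add: "ratfun_of_poly (p + q) = ratfun_of_poly p + ratfun_of_poly q"
  by (simp add: ratfun_of_poly_altdef flip: to_fract_add)

lemma ratfun_of_poly_mult: "ratfun_of_poly (p * q) = ratfun_of_poly p * ratfun_of_poly q"
  by (simp add: ratfun_of_poly_altdef flip: to_fract_mult)

text \<open>Horner step for inductions over polynomials in x.\<close>

lemma ratfun_of_poly_pCons:
  "ratfun_of_poly (pCons z p) = ratfun_of_poly [:z:] + var_x * ratfun_of_poly p"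
  by (simp add: ratfun_of_poly_altdef var_x_altdef flip: to_fract_mult to_fract_add)

lemma var_x_neq_0 [simp]: "var_x \<noteq> 0"
  by (simp add: var_x_altdef)

lemma ratfun_deriv_simps [simp]:
  "ratfun_dx (ratfun_of_poly p) = ratfun_of_poly (pderiv p)" "ratfun_dy (ratfun_of_poly p) = 0"
  "ratfun_dx var_x = 1" "ratfun_dy var_x = 0" "ratfun_dx var_y = 0" "ratfun_dy var_y = 1"
  by (simp_all add: ratfun_of_poly_altdef var_x_altdef var_y_altdef ratfun_dx_to_fract
      ratfun_dy_to_fract map_poly_pCons map_poly_1 pderiv_pCons flip: one_pCons)

lemma poisson_algebra_ratfun: "poisson_algebra ratfun_scale ratfun_bracket"
proof
  fix z w :: complex and a b c :: ratfun2
  show "ratfun_scale z (a + b) = ratfun_scale z a + ratfun_scale z b"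
    by (simp add: ratfun_scale_def algebra_simps)
  show "ratfun_scale (z + w) a = ratfun_scale z a + ratfun_scale w a"
    using ratfun_of_poly_add[of "[:z:]" "[:w:]"] by (simp add: ratfun_scale_def algebra_simps)
  show "ratfun_scale z (ratfun_scale w a) = ratfun_scale (z * w) a"
    by (simp add: ratfun_scale_def flip: mult.assoc ratfun_of_poly_mult)
  show "ratfun_scale 1 a = a"
    by (simp add: ratfun_scale_def flip: one_pCons)
  show "ratfun_scale z a * b = ratfun_scale z (a * b)"
    by (simp add: ratfun_scale_def mult.assoc)
  show "ratfun_bracket a (b + c) = ratfun_bracket a b + ratfun_bracket a c"
    by (simp add: ratfun_bracket_def dx.add dy.add algebra_simps)
  show "ratfun_bracket a (ratfun_scale z b) = ratfun_scale z (ratfun_bracket a b)"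
    by (simp add: ratfun_bracket_def ratfun_scale_def dx.mult dy.mult pderiv_pCons algebra_simps)
  show "ratfun_bracket a b = - ratfun_bracket b a"
    by (simp add: ratfun_bracket_def algebra_simps)
  show "ratfun_bracket a (ratfun_bracket b c) + ratfun_bracket b (ratfun_bracket c a)
      + ratfun_bracket c (ratfun_bracket a b) = 0"
    by (simp add: ratfun_bracket_def dx.mult dy.mult dx.diff dy.diff ratfun_dx_dy algebra_simps)
  show "ratfun_bracket a (b * c) = ratfun_bracket a b * c + b * ratfun_bracket a c"
    by (simp add: ratfun_bracket_def dx.mult dy.mult algebra_simps)
qed

section \<open>Diagonal metrics and the Kaehler-Poisson condition\<close>

lemma ratfun_kp_simps [simp]:
  "scale (ratfun_kp g) = ratfun_scale" "bracket (ratfun_kp g) = ratfun_bracket"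
  "metric (ratfun_kp g) = g" "gens (ratfun_kp g) $ 1 = var_x" "gens (ratfun_kp g) $ 2 = var_y"
  by (simp_all add: ratfun_kp_def)

lemma diag_metric_simps [simp]:
  "diag_metric a c $ 1 $ 1 = ratfun_of_poly a" "diag_metric a c $ 1 $ 2 = 0"
  "diag_metric a c $ 2 $ 1 = 0" "diag_metric a c $ 2 $ 2 = ratfun_of_poly c"
  by (simp_all add: diag_metric_def)

lemma det_diag_metric_eq_0_iff: "det (diag_metric a c) = 0 \<longleftrightarrow> a = 0 \<or> c = 0"
  by (simp add: det_2)

lemma metric_form_diag:
  "metric_form (ratfun_kp (diag_metric a c)) \<beta> \<gamma> =
     \<beta> var_x * ratfun_of_poly a * \<gamma> var_x + \<beta> var_y * ratfun_of_poly c * \<gamma> var_y"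
  by (simp add: metric_form_def sum_2)

lemma ratfun_bracket_gens:
  "ratfun_bracket f var_x = - (var_x * ratfun_dy f)" "ratfun_bracket f var_y = var_x * ratfun_dx f"
  "ratfun_bracket var_x f = var_x * ratfun_dy f" "ratfun_bracket var_y f = - (var_x * ratfun_dx f)"
  by (simp_all add: ratfun_bracket_def)

lemma kaehler_poisson_diag:
  assumes "a \<noteq> 0" "c \<noteq> 0"
  shows "kaehler_poisson (ratfun_kp (diag_metric a c))"
proof -
  let ?K = "ratfun_kp (diag_metric a c)"
  \<comment> \<open>With two generators the quadruple sum collapses to
    \<open>- \<eta> * det g * {x,y}\<^sup>2 * {f,h}\<close>; here the determinant is
    \<open>a * c\<close> and \<open>{x,y} = x\<close>.\<close>
  define \<eta> where "\<eta> = inverse (ratfun_of_poly a * ratfun_of_poly c * var_x\<^sup>2)"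
  have \<eta>: "\<eta> * (ratfun_of_poly a * ratfun_of_poly c * var_x\<^sup>2) = 1"
    unfolding \<eta>_def using assms by (intro left_inverse) simp
  have "(\<Sum>i\<in>UNIV. \<Sum>j\<in>UNIV. \<Sum>k\<in>UNIV. \<Sum>l\<in>UNIV.
           \<eta> * bracket ?K f (gens ?K $ i) * metric ?K $ i $ j
             * bracket ?K (gens ?K $ j) (gens ?K $ k)
             * metric ?K $ k $ l * bracket ?K (gens ?K $ l) h)
        = - (\<eta> * (ratfun_of_poly a * ratfun_of_poly c * var_x\<^sup>2)) * bracket ?K f h" for f h
    by (simp add: sum_2 ratfun_bracket_gens ratfun_bracket_def algebra_simps power2_eq_square)
  then have "\<forall>f h. (\<Sum>i\<in>UNIV. \<Sum>j\<in>UNIV. \<Sum>k\<in>UNIV. \<Sum>l\<in>UNIV.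
           \<eta> * bracket ?K f (gens ?K $ i) * metric ?K $ i $ j
             * bracket ?K (gens ?K $ j) (gens ?K $ k)
             * metric ?K $ k $ l * bracket ?K (gens ?K $ l) h) = - bracket ?K f h"
    unfolding \<eta> by simp
  moreover have "transpose (metric ?K) = metric ?K"
    by (simp add: vec_eq_iff forall_2 transpose_def)
  moreover have "poisson_algebra (scale ?K) (bracket ?K)"
    by (simp add: poisson_algebra_ratfun)
  ultimately show ?thesis
    unfolding kaehler_poisson_def by blast
qed

section \<open>The subalgebra generated by x and y\<close>

lemma is_subalgebra_polys: "is_subalgebra (ratfun_kp g) (range to_fract)"
proof -
  have "1 \<in> range (to_fract :: complex poly poly \<Rightarrow> _)"
    using to_fract_1 by (metis rangeI)
  moreover have "to_fract p + to_fract q \<in> range to_fract" "to_fract p * to_fract q \<in> range to_fract"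
    for p q :: "complex poly poly"
    by (metis to_fract_add rangeI) (metis to_fract_mult rangeI)
  moreover from this have "ratfun_scale z (to_fract p) \<in> range to_fract" for z p
    by (simp add: ratfun_scale_def ratfun_of_poly_altdef)
  ultimately show ?thesis
    by (auto simp: is_subalgebra_def)
qed

text \<open>Scalar multiples of 1 give the constants, Horner's scheme in x then gives the
  coefficients, and Horner's scheme in y the rest.\<close>

lemma polys_subset_subalgebra:
  assumes S: "is_subalgebra (ratfun_kp g) S" and x: "var_x \<in> S" and y: "var_y \<in> S"
  shows "range to_fract \<subseteq> S"
proof -
  have S1: "1 \<in> S" and Sadd: "\<And>u v. u \<in> S \<Longrightarrow> v \<in> S \<Longrightarrow> u + v \<in> S"
    and Smult: "\<And>u v. u \<in> S \<Longrightarrow> v \<in> S \<Longrightarrow> u * v \<in> S"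
    and Sscale: "\<And>z u. u \<in> S \<Longrightarrow> ratfun_scale z u \<in> S"
    using S by (auto simp: is_subalgebra_def)
  have const: "ratfun_of_poly [:z:] \<in> S" for z
    using Sscale[OF S1, of z] by (simp add: ratfun_scale_def)
  have coeff: "ratfun_of_poly p \<in> S" for p
  proof (induction p)
    case 0
    show ?case using const[of 0] by simp
  next
    case (pCons z p)
    then show ?case
      by (subst ratfun_of_poly_pCons) (intro Sadd Smult const x)
  qed
  have "to_fract P \<in> S" for P
  proof (induction P)
    case 0
    show ?case using const[of 0] by simp
  next
    case (pCons p P)
    have "to_fract (pCons p P) = ratfun_of_poly p + var_y * to_fract P"
      by (simp add: ratfun_of_poly_altdef var_y_altdef flip: to_fract_add to_fract_mult)
    with pCons show ?case by (simp add: Sadd Smult coeff y)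
  qed
  then show ?thesis by blast
qed

text \<open>Turns the fourth morphism condition into the preservation of polynomials.\<close>

lemma fin_subalgebra_ratfun: "fin_subalgebra (ratfun_kp g) = range to_fract"
proof
  have gens: "range (\<lambda>i. gens (ratfun_kp g) $ i) = {var_x, var_y}"
    by (auto simp: UNIV_2)
  have "{var_x, var_y} \<subseteq> range to_fract"
    by (simp add: var_x_altdef var_y_altdef)
  then show "fin_subalgebra (ratfun_kp g) \<subseteq> range to_fract"
    unfolding fin_subalgebra_def gens by (rule hull_minimal) (rule is_subalgebra_polys)
  show "range to_fract \<subseteq> fin_subalgebra (ratfun_kp g)"
    unfolding fin_subalgebra_def gens hull_def
    using polys_subset_subalgebra by (intro Inter_greatest) blast
qed

section \<open>Dilations of the first variable\<close>

text \<open>The substitution of \<alpha> x for x with y fixed: x lives in the coefficients, so it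
  acts on each of them separately.\<close>

definition poly_dilation :: "complex \<Rightarrow> complex poly poly \<Rightarrow> complex poly poly" where
  "poly_dilation \<alpha> = map_poly (\<lambda>p. pcompose p [:0, \<alpha>:])"

definition dilation :: "complex \<Rightarrow> ratfun2 \<Rightarrow> ratfun2" where
  "dilation \<alpha> = fract_map (poly_dilation \<alpha>)"

lemma coeff_poly_dilation [simp]:
  "coeff (poly_dilation \<alpha> P) n = pcompose (coeff P n) [:0, \<alpha>:]"
  by (simp add: poly_dilation_def coeff_map_poly)

lemma poly_dilation_add: "poly_dilation \<alpha> (P + Q) = poly_dilation \<alpha> P + poly_dilation \<alpha> Q"
  by (rule poly_eqI) (simp add: pcompose_add)

lemma poly_dilation_smult:
  "poly_dilation \<alpha> (smult p P) = smult (pcompose p [:0, \<alpha>:]) (poly_dilation \<alpha> P)"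
  by (rule poly_eqI) (simp add: pcompose_mult)

lemma poly_dilation_pCons:
  "poly_dilation \<alpha> (pCons p P) = pCons (pcompose p [:0, \<alpha>:]) (poly_dilation \<alpha> P)"
  by (simp add: poly_dilation_def map_poly_pCons)

text \<open>For nonzero \<alpha> the substituted polynomial has positive degree, so no nonzero
  coefficient is sent to zero.\<close>

lemma idom_embedding_poly_dilation:
  assumes "\<alpha> \<noteq> 0"
  shows "idom_embedding (poly_dilation \<alpha>)"
proof
  fix P Q :: "complex poly poly"
  show "poly_dilation \<alpha> (P + Q) = poly_dilation \<alpha> P + poly_dilation \<alpha> Q"
    by (rule poly_dilation_add)
  show "poly_dilation \<alpha> (P * Q) = poly_dilation \<alpha> P * poly_dilation \<alpha> Q"
  proof (induction P)
    case 0
    show ?case by (simp add: poly_dilation_def)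
  next
    case (pCons p P)
    then show ?case
      by (simp add: poly_dilation_add poly_dilation_smult poly_dilation_pCons)
  qed
  show "poly_dilation \<alpha> 1 = 1"
    by (simp add: poly_dilation_def map_poly_1 pcompose_1)
  show "poly_dilation \<alpha> P = 0 \<longleftrightarrow> P = 0"
    unfolding poly_dilation_def by (rule map_poly_eq_0_iff) (use assms in \<open>auto simp: pcompose_eq_0_iff\<close>)
qed

lemma pderiv_poly_dilation: "pderiv (poly_dilation \<alpha> P) = poly_dilation \<alpha> (pderiv P)"
  by (rule poly_eqI) (simp add: coeff_pderiv pcompose_smult of_nat_poly del: of_nat_Suc)

text \<open>Chain rule; the inner derivative is the constant \<alpha>.\<close>

lemma map_poly_pderiv_poly_dilation:
  "map_poly pderiv (poly_dilation \<alpha> P) = smult [:\<alpha>:] (poly_dilation \<alpha> (map_poly pderiv P))"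
  by (rule poly_eqI) (simp add: coeff_map_poly pderiv_pcompose pderiv_pCons)

lemma poly_dilation_inverse:
  assumes "\<alpha> * \<beta> = 1"
  shows "poly_dilation \<alpha> (poly_dilation \<beta> P) = P"
proof (rule poly_eqI)
  fix n
  have "pcompose [:0, \<beta>:] [:0, \<alpha>:] = [:0, 1:]"
    using assms by (simp add: pcompose_pCons mult.commute)
  then show "coeff (poly_dilation \<alpha> (poly_dilation \<beta> P)) n = coeff P n"
    by (simp flip: pcompose_assoc)
qed

context
  fixes \<alpha> :: complex
  assumes \<alpha>: "\<alpha> \<noteq> 0"
begin

interpretation idom_embedding "poly_dilation \<alpha>"
  using \<alpha> by (rule idom_embedding_poly_dilation)

lemma dilation_add: "dilation \<alpha> (f + g) = dilation \<alpha> f + dilation \<alpha> g"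
  by (simp add: dilation_def fract_map_add)

lemma dilation_mult: "dilation \<alpha> (f * g) = dilation \<alpha> f * dilation \<alpha> g"
  by (simp add: dilation_def fract_map_mult)

lemma dilation_to_fract: "dilation \<alpha> (to_fract P) = to_fract (poly_dilation \<alpha> P)"
  by (simp add: dilation_def)

lemma dilation_of_poly [simp]:
  "dilation \<alpha> (ratfun_of_poly p) = ratfun_of_poly (pcompose p [:0, \<alpha>:])"
  by (simp add: ratfun_of_poly_altdef dilation_to_fract poly_dilation_pCons)

lemma dilation_var_x: "dilation \<alpha> var_x = ratfun_scale \<alpha> var_x"
  by (simp add: var_x_altdef ratfun_scale_def ratfun_of_poly_altdef dilation_to_fract
      poly_dilation_pCons pcompose_pCons flip: to_fract_mult)

lemma dilation_var_y: "dilation \<alpha> var_y = var_y"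
  by (simp add: var_y_altdef dilation_to_fract poly_dilation_pCons pcompose_1)

lemma dilation_dy: "ratfun_dy (dilation \<alpha> f) = dilation \<alpha> (ratfun_dy f)"
proof -
  obtain p q where "f = Fract p q" "q \<noteq> 0" by (cases f)
  then show ?thesis
    by (simp add: dilation_def fract_map_Fract ratfun_dy_Fract pderiv_poly_dilation mult diff)
qed

lemma dilation_dx: "ratfun_dx (dilation \<alpha> f) = ratfun_scale \<alpha> (dilation \<alpha> (ratfun_dx f))"
proof -
  obtain p q where "f = Fract p q" "q \<noteq> 0" by (cases f)
  then show ?thesis
    by (simp add: dilation_def fract_map_Fract ratfun_dx_Fract map_poly_pderiv_poly_dilation mult
        diff ratfun_scale_def ratfun_of_poly_def smult_diff_right)
qed

lemma dilation_scale: "dilation \<alpha> (ratfun_scale z f) = ratfun_scale z (dilation \<alpha> f)"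
  by (simp add: ratfun_scale_def dilation_mult)

lemma dilation_zero [simp]: "dilation \<alpha> 0 = 0"
  using dilation_of_poly[of 0] by simp

lemma dilation_one [simp]: "dilation \<alpha> 1 = 1"
  using dilation_of_poly[of 1] by (simp add: pcompose_1)

lemma dilation_diff: "dilation \<alpha> (f - g) = dilation \<alpha> f - dilation \<alpha> g"
  by (metis dilation_add add_diff_cancel_right' diff_add_cancel)

lemma dilation_sum: "dilation \<alpha> (sum f A) = (\<Sum>i\<in>A. dilation \<alpha> (f i))"
  by (induction A rule: infinite_finite_induct) (simp_all add: dilation_add)

text \<open>The factor \<alpha> that the chain rule puts on each x-derivative equals the one coming
  from the prefactor x of the bracket.\<close>

lemma dilation_bracket:
  "dilation \<alpha> (ratfun_bracket f g) = ratfun_bracket (dilation \<alpha> f) (dilation \<alpha> g)"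
  by (simp add: ratfun_bracket_def dilation_mult dilation_diff dilation_dx dilation_dy
      dilation_var_x ratfun_scale_def algebra_simps)

lemma poisson_hom_dilation: "poisson_hom (ratfun_kp g) (ratfun_kp g') (dilation \<alpha>)"
  using poisson_algebra_ratfun
  by (simp add: poisson_hom_def Vector_Spaces.linear_iff poisson_algebra_def dilation_add dilation_scale
      dilation_mult dilation_bracket)

end

lemma dilation_inverse:
  assumes "\<alpha> * \<beta> = 1"
  shows "dilation \<alpha> (dilation \<beta> f) = f"
proof -
  have "\<alpha> \<noteq> 0" "\<beta> \<noteq> 0" using assms by auto
  moreover obtain p q where "f = Fract p q" "q \<noteq> 0" by (cases f)
  ultimately show ?thesis
    using assms
    by (simp add: Fract_conv_to_fract dilation_def poly_dilation_inverse
        idom_embedding.fract_map_Fract idom_embedding.eq_0_iff idom_embedding_poly_dilation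
        flip: Fract_conv_to_fract)
qed

section \<open>Conjugating inner derivations by dilations\<close>

lemma inner_dersI: "(\<lambda>b. \<Sum>i<n::nat. r i * bracket K (c i) b) \<in> inner_ders K"
  by (auto simp: inner_ders_def)

lemma bracket_in_inner_ders: "bracket K c \<in> inner_ders K"
  using inner_dersI[where n = 1 and r = "\<lambda>_. 1" and c = "\<lambda>_. c"] by simp

lemma inner_der_scale:
  assumes "D \<in> inner_ders (ratfun_kp g)"
  shows "D (ratfun_scale z f) = ratfun_scale z (D f)"
proof -
  interpret poisson_algebra ratfun_scale ratfun_bracket by (rule poisson_algebra_ratfun)
  obtain n :: nat and r c where "D = (\<lambda>b. \<Sum>i<n. r i * ratfun_bracket (c i) b)"
    using assms by (auto simp: inner_ders_def)
  then show ?thesis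
    by (simp add: bracket_scale scale_sum_right) (simp add: ratfun_scale_def algebra_simps)
qed

text \<open>Dilations preserve brackets, so conjugation only replaces each \<open>r i\<close> and
  \<open>c i\<close> by its dilation.\<close>

lemma conjugate_dilation_in_inner_ders:
  assumes D: "D \<in> inner_ders (ratfun_kp g)" and "\<alpha> * \<beta> = 1"
  shows "(\<lambda>b. dilation \<alpha> (D (dilation \<beta> b))) \<in> inner_ders (ratfun_kp g')"
proof -
  have \<alpha>: "\<alpha> \<noteq> 0" using assms by auto
  obtain n :: nat and r c where "D = (\<lambda>b. \<Sum>i<n. r i * ratfun_bracket (c i) b)"
    using D by (auto simp: inner_ders_def)
  then have "(\<lambda>b. dilation \<alpha> (D (dilation \<beta> b))) =
      (\<lambda>b. \<Sum>i<n. dilation \<alpha> (r i) * ratfun_bracket (dilation \<alpha> (c i)) b)"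
    using \<alpha> by (simp add: dilation_sum dilation_mult dilation_bracket dilation_inverse assms(2))
  then show ?thesis
    using inner_dersI[where K = "ratfun_kp g'"] by simp
qed

lemma kp_morphism_dilation:
  assumes \<alpha>\<beta>: "\<alpha> * \<beta> = 1"
    and nz: "a \<noteq> 0" "c \<noteq> 0" "a' \<noteq> 0" "c' \<noteq> 0"
    and c': "c' = pcompose c [:0, \<alpha>:]" and a': "a' = smult (\<alpha>\<^sup>2) (pcompose a [:0, \<alpha>:])"
  shows "kp_morphism (ratfun_kp (diag_metric a c)) (ratfun_kp (diag_metric a' c'))
    (dilation \<alpha>) (\<lambda>D b. dilation \<alpha> (D (dilation \<beta> b)))"
proof -
  have \<alpha>: "\<alpha> \<noteq> 0" and \<beta>: "\<beta> \<noteq> 0" and \<beta>\<alpha>: "\<beta> * \<alpha> = 1"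
    using \<alpha>\<beta> by (auto simp: mult.commute)
  note inv = dilation_inverse[OF \<alpha>\<beta>] dilation_inverse[OF \<beta>\<alpha>]
  let ?K = "ratfun_kp (diag_metric a c)" and ?K' = "ratfun_kp (diag_metric a' c')"
  let ?\<psi> = "\<lambda>D b. dilation \<alpha> (D (dilation \<beta> b))"
  \<comment> \<open>In a composite of two conjugates the inner dilations by \<beta> and \<alpha>
    cancel, so conjugation respects commutators.\<close>
  have lie: "inner_ders_lie_hom ?K ?K' ?\<psi>"
    unfolding inner_ders_lie_hom_def
    using \<alpha> by (simp add: conjugate_dilation_in_inner_ders \<alpha>\<beta> dilation_add dilation_scale
        dilation_diff inv)
  have metric: "dilation \<alpha> (metric_form ?K D E) = metric_form ?K' (?\<psi> D) (?\<psi> E)"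
    if D: "D \<in> inner_ders ?K" and E: "E \<in> inner_ders ?K" for D E
  proof -
    have A': "ratfun_of_poly a' = ratfun_of_poly [:\<alpha>:] * ratfun_of_poly [:\<alpha>:]
        * dilation \<alpha> (ratfun_of_poly a)"
      using \<alpha> by (simp add: a' power2_eq_square flip: ratfun_of_poly_mult)
    have one: "ratfun_of_poly [:\<alpha>:] * ratfun_of_poly [:\<beta>:] = 1"
      using \<alpha>\<beta> by (simp add: mult.commute flip: ratfun_of_poly_mult one_pCons)
    \<comment> \<open>The inverse dilation sends x to \<beta> x, so each argument of the form
      contributes a factor \<beta>; the two are cancelled by the square of \<alpha> in
      \<open>a'\<close>.\<close>
    have x: "?\<psi> F var_x = ratfun_of_poly [:\<beta>:] * dilation \<alpha> (F var_x)"
      if "F \<in> inner_ders ?K" for F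
      using \<alpha> by (simp add: dilation_var_x[OF \<beta>] inner_der_scale[OF that] dilation_scale)
        (simp add: ratfun_scale_def)
    have "metric_form ?K' (?\<psi> D) (?\<psi> E) =
        (ratfun_of_poly [:\<alpha>:] * ratfun_of_poly [:\<beta>:])\<^sup>2 * (dilation \<alpha> (D var_x)
          * dilation \<alpha> (ratfun_of_poly a) * dilation \<alpha> (E var_x))
        + dilation \<alpha> (D var_y) * ratfun_of_poly c' * dilation \<alpha> (E var_y)"
      unfolding metric_form_diag x[OF D] x[OF E] A' dilation_var_y[OF \<beta>]
      by (simp add: power2_eq_square algebra_simps)
    also have "\<dots> = dilation \<alpha> (metric_form ?K D E)"
      using \<alpha> by (simp add: one metric_form_diag dilation_add dilation_mult c')
    finally show ?thesis ..
  qed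
  have "dilation \<alpha> ` fin_subalgebra ?K \<subseteq> fin_subalgebra ?K'"
    using \<alpha> by (auto simp: fin_subalgebra_ratfun dilation_to_fract)
  with lie metric show ?thesis
    unfolding kp_morphism_def
    using nz \<alpha> by (simp add: kaehler_poisson_diag poisson_hom_dilation dilation_mult inv)
qed

section \<open>Polynomial Poisson automorphisms\<close>

text \<open>The bracket of two polynomials is x times their Jacobian determinant, again a
  polynomial; this is the source of divisibility by x.\<close>

lemma ratfun_bracket_to_fract:
  "ratfun_bracket (to_fract P) (to_fract Q) =
     var_x * to_fract (map_poly pderiv P * pderiv Q - pderiv P * map_poly pderiv Q)"
  by (simp add: ratfun_bracket_def ratfun_dx_to_fract ratfun_dy_to_fract)

lemma poisson_hom_ratfunD:
  assumes "poisson_hom (ratfun_kp g) (ratfun_kp g') \<phi>"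
  shows "\<phi> (f + h) = \<phi> f + \<phi> h" "\<phi> (f * h) = \<phi> f * \<phi> h"
    "\<phi> (ratfun_scale z f) = ratfun_scale z (\<phi> f)"
    "\<phi> (ratfun_bracket f h) = ratfun_bracket (\<phi> f) (\<phi> h)"
    "\<phi> (ratfun_of_poly [:z:]) = ratfun_of_poly [:z:]"
proof -
  show scale: "\<phi> (ratfun_scale z f) = ratfun_scale z (\<phi> f)" for z f
    using assms by (simp add: poisson_hom_def Vector_Spaces.linear_iff)
  have "\<phi> 1 = 1" using assms by (simp add: poisson_hom_def)
  with scale[of z 1] show "\<phi> (ratfun_of_poly [:z:]) = ratfun_of_poly [:z:]"
    by (simp add: ratfun_scale_def)
qed (use assms in \<open>simp_all add: poisson_hom_def Vector_Spaces.linear_iff\<close>)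

text \<open>The image of x determines the homomorphism on polynomials in x, whatever happens to
  y.\<close>

lemma poisson_hom_of_poly:
  assumes "poisson_hom (ratfun_kp g) (ratfun_kp g') \<phi>" and x: "\<phi> var_x = ratfun_scale \<alpha> var_x"
  shows "\<phi> (ratfun_of_poly p) = ratfun_of_poly (pcompose p [:0, \<alpha>:])"
proof (induction p)
  case 0
  show ?case using poisson_hom_ratfunD(5)[OF assms(1), of 0] by simp
next
  case (pCons z p)
  have "\<phi> (ratfun_of_poly (pCons z p)) = ratfun_of_poly [:z:]
      + ratfun_scale \<alpha> var_x * ratfun_of_poly (pcompose p [:0, \<alpha>:])"
    by (subst ratfun_of_poly_pCons)
      (simp add: poisson_hom_ratfunD[OF assms(1)] x pCons.IH)
  also have "\<dots> = ratfun_of_poly (pcompose (pCons z p) [:0, \<alpha>:])"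
    by (simp add: pcompose_pCons ratfun_scale_def ratfun_of_poly_altdef var_x_altdef
        flip: to_fract_add to_fract_mult)
  finally show ?case .
qed

lemma irreducible_x: "irreducible [:[:0, 1:] :: complex poly:]"
  by (simp add: irreducible_const_poly_iff irreducible_linear_field_poly)

text \<open>Irreducibility enters after applying \<phi> to \<open>\<theta> x = x * J\<close>: this
  factors x as \<open>\<phi> x * \<phi> J\<close> among polynomials, so one factor is constant, and
  it can only be the second.\<close>

lemma poisson_automorphism_polys:
  assumes \<phi>: "poisson_hom (ratfun_kp g) (ratfun_kp g') \<phi>"
    and \<theta>: "poisson_hom (ratfun_kp g') (ratfun_kp g) \<theta>"
    and \<phi>\<theta>: "\<And>f. \<phi> (\<theta> f) = f" and \<theta>\<phi>: "\<And>f. \<theta> (\<phi> f) = f"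
    and \<phi>_poly: "\<And>P. \<phi> (to_fract P) \<in> range to_fract"
    and \<theta>_poly: "\<And>P. \<theta> (to_fract P) \<in> range to_fract"
  obtains \<beta> r where "\<beta> \<noteq> 0" "\<theta> var_x = ratfun_scale \<beta> var_x"
    "\<theta> var_y = var_y + ratfun_of_poly r"
proof -
  obtain P Q where P: "\<theta> var_x = to_fract P" and Q: "\<theta> var_y = to_fract Q"
    using \<theta>_poly unfolding var_x_altdef var_y_altdef by blast
  define J where "J = map_poly pderiv P * pderiv Q - pderiv P * map_poly pderiv Q"
  \<comment> \<open>Apply \<theta> to \<open>{x,y} = x\<close>; the bracket of the two images has
    the factor x.\<close>
  have \<theta>x: "\<theta> var_x = var_x * to_fract J"
    using poisson_hom_ratfunD(4)[OF \<theta>, of var_x var_y]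
    by (simp only: ratfun_bracket_var P Q ratfun_bracket_to_fract J_def)
  obtain X' J' where X': "\<phi> var_x = to_fract X'" and J': "\<phi> (to_fract J) = to_fract J'"
    using \<phi>_poly unfolding var_x_altdef by blast
  have "var_x = \<phi> (var_x * to_fract J)"
    using \<theta>x \<phi>\<theta> by metis
  also have "\<dots> = to_fract (X' * J')"
    by (simp add: poisson_hom_ratfunD[OF \<phi>] X' J')
  finally have "[:[:0, 1:]:] = X' * J'"
    by (simp only: var_x_altdef to_fract_eq_iff)
  then have "is_unit X' \<or> is_unit J'"
    using irreducible_x by (metis irreducibleD)
  have unit: "\<exists>z. U = [:[:z:]:]" if "is_unit U" for U :: "complex poly poly"
    using that by (metis is_unit_poly_iff)
  \<comment> \<open>A unit is a constant, and \<theta> fixes constants, so x itself would be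
    constant.\<close>
  have "\<not> is_unit X'"
  proof
    assume "is_unit X'"
    then obtain z where "X' = [:[:z:]:]" using unit by blast
    then have "\<phi> var_x = ratfun_of_poly [:z:]" by (simp add: X' ratfun_of_poly_altdef)
    then have "var_x = ratfun_of_poly [:z:]"
      by (metis \<theta>\<phi> poisson_hom_ratfunD(5)[OF \<theta>])
    then show False by (simp add: var_x_altdef ratfun_of_poly_altdef)
  qed
  with \<open>is_unit X' \<or> is_unit J'\<close> obtain \<beta> where "J' = [:[:\<beta>:]:]" using unit by blast
  then have "to_fract J = ratfun_of_poly [:\<beta>:]"
    using J' by (metis \<theta>\<phi> poisson_hom_ratfunD(5)[OF \<theta>] ratfun_of_poly_altdef)
  with \<theta>x have x: "\<theta> var_x = ratfun_scale \<beta> var_x"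
    by (simp add: ratfun_scale_def mult.commute)
  have "\<beta> \<noteq> 0"
  proof
    assume "\<beta> = 0"
    then have "\<theta> var_x = ratfun_of_poly [:0:]" by (simp add: x ratfun_scale_def)
    then have "var_x = ratfun_of_poly [:0:]"
      by (metis \<phi>\<theta> poisson_hom_ratfunD(5)[OF \<phi>])
    then show False by simp
  qed
  \<comment> \<open>Knowing the image of x, the same bracket relation says that Q has y-derivative
    1, so \<open>Q - y\<close> has degree 0 in y.\<close>
  have "ratfun_bracket (ratfun_scale \<beta> var_x) (to_fract Q) = ratfun_scale \<beta> var_x"
    using poisson_hom_ratfunD(4)[OF \<theta>, of var_x var_y] by (simp add: ratfun_bracket_var x Q)
  then have "to_fract (pderiv Q) = 1"
    using \<open>\<beta> \<noteq> 0\<close>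
    by (simp add: ratfun_bracket_def ratfun_scale_def dx.mult dy.mult ratfun_dy_to_fract pderiv_pCons)
  then have "pderiv (Q - [:0, 1:]) = 0"
    by (simp add: pderiv_diff pderiv_pCons flip: one_pCons to_fract_1)
  then obtain r where "Q - [:0, 1:] = [:r:]"
    by (auto simp: pderiv_eq_0_iff elim: degree_eq_zeroE)
  then have "Q = [:0, 1:] + [:r:]" by (simp add: algebra_simps)
  then have "\<theta> var_y = var_y + ratfun_of_poly r"
    unfolding Q by (simp only: var_y_altdef ratfun_of_poly_altdef to_fract_add)
  with \<open>\<beta> \<noteq> 0\<close> x show thesis by (rule that)
qed

theorem proposition3p8:
  fixes a c a' c' :: "complex poly"
  assumes "det (diag_metric a c) \<noteq> 0" and "det (diag_metric a' c') \<noteq> 0"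
  shows "kp_isomorphic (ratfun_kp (diag_metric a c)) (ratfun_kp (diag_metric a' c')) \<longleftrightarrow>
    (\<exists>\<alpha>::complex. c' = pcompose c [:0, \<alpha>:] \<and> a' = smult (\<alpha>\<^sup>2) (pcompose a [:0, \<alpha>:]))"
    (is "kp_isomorphic ?K ?K' \<longleftrightarrow> ?R")
proof -
  have nz: "a \<noteq> 0" "c \<noteq> 0" "a' \<noteq> 0" "c' \<noteq> 0"
    using assms by (simp_all add: det_diag_metric_eq_0_iff)
  show ?thesis
  proof
    assume "kp_isomorphic ?K ?K'"
    then obtain \<phi> \<psi> \<theta> \<omega> where \<phi>: "kp_morphism ?K ?K' \<phi> \<psi>" and \<theta>: "kp_morphism ?K' ?K \<theta> \<omega>"
      and \<theta>\<phi>: "\<theta> (\<phi> f) = f" and \<phi>\<theta>: "\<phi> (\<theta> f) = f" for f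
      unfolding kp_isomorphic_def by blast
    have \<phi>_hom: "poisson_hom ?K ?K' \<phi>" and \<theta>_hom: "poisson_hom ?K' ?K \<theta>"
      using \<phi> \<theta> by (simp_all add: kp_morphism_def)
    note \<phi>D = poisson_hom_ratfunD[OF \<phi>_hom]
    have "\<phi> (to_fract P) \<in> range to_fract" "\<theta> (to_fract P) \<in> range to_fract" for P
      using \<phi> \<theta> by (auto simp: kp_morphism_def fin_subalgebra_ratfun)
    then obtain \<beta> r where \<beta>: "\<beta> \<noteq> 0" and \<theta>x: "\<theta> var_x = ratfun_scale \<beta> var_x"
      and \<theta>y: "\<theta> var_y = var_y + ratfun_of_poly r"
      using poisson_automorphism_polys[OF \<phi>_hom \<theta>_hom \<phi>\<theta> \<theta>\<phi>] by metis
    \<comment> \<open>\<theta> runs from the second algebra to the first, whereas the stated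
      formulas transport \<open>a\<close> and \<open>c\<close> along its inverse \<phi>, which
      scales x by \<alpha>.\<close>
    define \<alpha> where "\<alpha> = inverse \<beta>"
    have \<alpha>: "\<alpha> \<noteq> 0" "\<alpha> * \<beta> = 1" using \<beta> by (simp_all add: \<alpha>_def)
    have \<beta>\<phi>x: "ratfun_scale \<beta> (\<phi> var_x) = var_x"
      using \<phi>D(3) \<theta>x \<phi>\<theta> by metis
    have one: "ratfun_of_poly [:\<alpha>:] * ratfun_of_poly [:\<beta>:] = 1"
      using \<alpha> by (simp add: mult.commute flip: ratfun_of_poly_mult one_pCons)
    then have \<phi>x: "\<phi> var_x = ratfun_scale \<alpha> var_x"
      using \<beta>\<phi>x unfolding ratfun_scale_def by (metis mult.assoc mult_1)
    then have \<phi>x_nz: "\<phi> var_x \<noteq> 0"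
      using \<alpha> by (simp add: ratfun_scale_def)
    note \<phi>_poly = poisson_hom_of_poly[OF \<phi>_hom \<phi>x]
    have \<phi>_0: "\<phi> 0 = 0" using \<phi>_poly[of 0] by simp
    have \<phi>_minus: "\<phi> (- f) = - \<phi> f" for f
      using \<phi>D(1)[of f "- f"] by (simp add: \<phi>_0 eq_neg_iff_add_eq_0 add.commute)
    \<comment> \<open>These two derivations separate the metric entries: the first kills x, the
      second kills y.\<close>
    let ?D = "ratfun_bracket var_x" and ?E = "ratfun_bracket var_y"
    have D: "?D \<in> inner_ders ?K" and E: "?E \<in> inner_ders ?K"
      using bracket_in_inner_ders[of ?K] by simp_all
    \<comment> \<open>The second morphism condition, evaluated at \<theta> f, forces \<psi> to be
      conjugation.\<close>
    have \<psi>: "\<psi> F f = \<phi> (F (\<theta> f))" if "F \<in> inner_ders ?K" for F f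
      using \<phi> that \<phi>\<theta> unfolding kp_morphism_def by metis
    have metric: "\<phi> (metric_form ?K F G) = metric_form ?K' (\<psi> F) (\<psi> G)"
      if "F \<in> inner_ders ?K" "G \<in> inner_ders ?K" for F G
      using \<phi> that unfolding kp_morphism_def by blast
    note simps = metric_form_diag \<psi>[OF D] \<psi>[OF E] ratfun_bracket_gens \<theta>x \<theta>y \<phi>D(1,2,5) \<phi>_0 \<phi>_minus
      ratfun_scale_def dx.mult dy.mult dx.add dy.add pderiv_pCons
    \<comment> \<open>Only the y-components survive, and both sides carry the square of
      \<open>\<phi> x\<close>.\<close>
    have "\<phi> (ratfun_of_poly c) = ratfun_of_poly c'"
      using metric[OF D D] \<phi>x_nz by (simp add: simps)
    then have c': "c' = pcompose c [:0, \<alpha>:]"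
      by (simp add: \<phi>_poly)
    \<comment> \<open>The left side vanishes since the metric is diagonal; the right side is, up to
      sign, the square of \<open>\<phi> x\<close> times \<open>c'\<close> times the image of the
      derivative of r.\<close>
    have "\<phi> (ratfun_of_poly (pderiv r)) = 0"
      using metric[OF D E] \<phi>x_nz nz by (simp add: simps)
    then have r: "pderiv r = 0"
      using \<alpha> by (simp add: \<phi>_poly pcompose_eq_0_iff)
    \<comment> \<open>With r constant only the x-components remain; evaluating at
      \<open>\<theta> x = \<beta> x\<close> twice yields the two factors \<beta>.\<close>
    have "\<phi> (ratfun_of_poly a) = ratfun_of_poly [:\<beta>:] * (ratfun_of_poly [:\<beta>:] * ratfun_of_poly a')"
      using metric[OF E E] \<phi>x_nz by (simp add: simps r)
    then have "pcompose a [:0, \<alpha>:] = smult (\<beta>\<^sup>2) a'"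
      by (simp add: \<phi>_poly power2_eq_square flip: ratfun_of_poly_mult)
    then have a': "a' = smult (\<alpha>\<^sup>2) (pcompose a [:0, \<alpha>:])"
      using \<alpha> by (simp flip: power_mult_distrib)
    from c' a' show ?R by blast
  next
    assume ?R
    then obtain \<alpha> where c': "c' = pcompose c [:0, \<alpha>:]"
      and a': "a' = smult (\<alpha>\<^sup>2) (pcompose a [:0, \<alpha>:])" by blast
    with nz have "\<alpha> \<noteq> 0" by auto
    define \<beta> where "\<beta> = inverse \<alpha>"
    have \<alpha>\<beta>: "\<alpha> * \<beta> = 1" and \<beta>\<alpha>: "\<beta> * \<alpha> = 1" using \<open>\<alpha> \<noteq> 0\<close> by (simp_all add: \<beta>_def)
    have undo: "pcompose (pcompose p [:0, \<alpha>:]) [:0, \<beta>:] = p" for p :: "complex poly"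
    proof -
      have "pcompose [:0, \<alpha>:] [:0, \<beta>:] = [:0, 1:]" using \<beta>\<alpha> by (simp add: pcompose_pCons mult.commute)
      then show ?thesis by (simp flip: pcompose_assoc)
    qed
    \<comment> \<open>The relation is symmetric under exchanging \<alpha> and \<beta>, so dilation
      by \<beta> is a morphism back.\<close>
    have c: "c = pcompose c' [:0, \<beta>:]"
      by (simp add: c' undo)
    have a: "a = smult (\<beta>\<^sup>2) (pcompose a' [:0, \<beta>:])"
      using \<beta>\<alpha> by (simp add: a' pcompose_smult undo flip: power_mult_distrib)
    show "kp_isomorphic ?K ?K'"
      unfolding kp_isomorphic_def
      using kp_morphism_dilation[OF \<alpha>\<beta> nz c' a'] kp_morphism_dilation[OF \<beta>\<alpha> nz(3,4,1,2) c a]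
        dilation_inverse[OF \<alpha>\<beta>] dilation_inverse[OF \<beta>\<alpha>]
      by (intro exI conjI) (assumption | simp)+
  qed
qed

end
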